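(* Let $E_1=\epsilon\,\#\,\phi_0\in X$, where $\epsilon(t)=t-t^2$ and $\phi_0$ is the first member of the family $(\phi_m)_{m\ge 0}$ of functions defined recursively in the context. Then $$\lim_{n\to\infty}E_1(2^{-n})\,2^{n}=\frac13+\frac{5}{14\sqrt7}.$$
   Context: Let $I=[0,1]\cap\mathbb Z[\tfrac12]$ and let $X$ be the $\mathbb Q$-vector space of all functions $I\to\mathbb Q$. Product $\#$. For $\alpha\in X$ let $\alpha_0,\alpha_1\in X$ be $\alpha_0(t)=\alpha(\tfrac t2)$ and $\alpha_1(t)=\alpha(\tfrac{1+t}2)$. The bilinear product $\#:X\times X\to X$ is defined by induction on the denominator of $t\in I$: (1) $(\alpha\#\beta)(0)=0$ and $(\alpha\#\beta)(1)=(\alpha(1)-\alpha(0))(\beta(1)-\beta(0))$; (2) if $0\le t\le\frac12$, $(\alpha\#\beta)(t)=(\alpha_0\#\beta_0)(2t)+(\alpha_1\#\beta_1)(2t)$; (3) if $\frac12\le t\le1$, $(\alpha\#\beta)(t)=(\alpha_0\#\beta_0)(1)+(\alpha_1\#\beta_1)(1)+(\alpha_0\#\beta_1)(2t-1)+(\alpha_1\#\beta_0)(2t-1)$. (These are consistent at $t=0,\frac12,1$.) The functions $\phi_m$. Let $\epsilon\in X$ be $\epsilon(t)=t-t^2$. For $m=0,1,2,\dots$, $\phi_m\in X$ is defined by induction on the denominator of $t$: (1) $\phi_m(0)=\phi_m(1)=0$; (2) if $0\le t\le\frac12$: $8\phi_m(t)=\phi_{m+1}(2t)+(8m+6)t$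 for $m$ even, and $8\phi_m(t)=\phi_{m-1}(2t)+\epsilon(2t)+(8m+6)t$ for $m$ odd; (3) if $\frac12\le t\le1$: $8\phi_0(t)=\phi_0(2t-1)+6(1-t)$; (4) if $\frac12\le t\le1$: $8\phi_m(t)=\phi_{m-1}(2t-1)+\epsilon(2t-1)+(8m+6)(1-t)$ for $m\neq0$ even, and $8\phi_m(t)=\phi_{m+1}(2t-1)+(8m+6)(1-t)$ for $m$ odd. (These are consistent at $t=0,\frac12,1$.) *)

theory Defs
  imports Complex_Main
begin

text \<open>The index set is [0,1] intersected with the ring of dyadic rationals. An element of X, the
  space of functions from this set to the rationals, is represented by a function of type
  \<^typ>\<open>rat \<Rightarrow> rat\<close> of which only the values on the index set matter (see \<open>sharp_cong\<close> below).\<close>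

definition dyadic_unit :: "rat set" where
  "dyadic_unit = {t. 0 \<le> t \<and> t \<le> 1 \<and> (\<exists>(k::int) (n::nat). t = of_int k / 2 ^ n)}"

definition lhalf :: "(rat \<Rightarrow> rat) \<Rightarrow> rat \<Rightarrow> rat" where
  "lhalf \<alpha> t = \<alpha> (t / 2)"

definition rhalf :: "(rat \<Rightarrow> rat) \<Rightarrow> rat \<Rightarrow> rat" where
  "rhalf \<alpha> t = \<alpha> ((1 + t) / 2)"

text \<open>The exponent of the denominator of a dyadic rational; used for termination only.\<close>

definition dlevel :: "rat \<Rightarrow> nat" where
  "dlevel t = (LEAST n. t * 2 ^ n \<in> \<int>)"

lemma dyadic_unitI:
  fixes k :: int and n :: nat
  assumes "t = of_int k / 2 ^ n" "0 \<le> t" "t \<le> 1"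
  shows "t \<in> dyadic_unit"
  using assms unfolding dyadic_unit_def by blast

lemma dyadic_unit_bounds: "t \<in> dyadic_unit \<Longrightarrow> 0 \<le> t \<and> t \<le> 1"
  unfolding dyadic_unit_def by blast

lemma dyadic_unit_0 [simp]: "0 \<in> dyadic_unit"
  by (rule dyadic_unitI[of _ 0 0]) simp_all

lemma dyadic_unit_1 [simp]: "1 \<in> dyadic_unit"
  by (rule dyadic_unitI[of _ 1 0]) simp_all

lemma dlevel_less:
  assumes "t \<in> dyadic_unit" "t \<noteq> 0" "t \<noteq> 1"
  shows "dlevel (2 * t) < dlevel t" "dlevel (2 * t - 1) < dlevel t" "dlevel 1 < dlevel t"
proof -
  obtain k :: int and n :: nat where kn: "t = of_int k / 2 ^ n"
    using assms(1) unfolding dyadic_unit_def by blast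
  have "t * 2 ^ n \<in> \<int>"
    by (simp add: kn)
  hence L: "t * 2 ^ dlevel t \<in> \<int>"
    unfolding dlevel_def by (rule LeastI)
  have "t \<notin> \<int>"
  proof
    assume "t \<in> \<int>"
    then obtain j :: int where j: "t = of_int j"
      by (auto elim: Ints_cases)
    have "0 < t" "t < 1"
      using assms unfolding dyadic_unit_def by auto
    hence "0 < j" "j < 1"
      unfolding j by simp_all
    thus False by simp
  qed
  with L obtain m where m: "dlevel t = Suc m"
    by (cases "dlevel t") auto
  have A: "2 * t * 2 ^ m \<in> \<int>"
    using L by (simp add: m mult_ac)
  have B: "(2 * t - 1) * 2 ^ m \<in> \<int>"
    using Ints_diff[OF A, of "2 ^ m"] by (simp add: algebra_simps)
  show "dlevel (2 * t) < dlevel t"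
    unfolding m less_Suc_eq_le dlevel_def[of "2 * t"] by (rule Least_le) (rule A)
  show "dlevel (2 * t - 1) < dlevel t"
    unfolding m less_Suc_eq_le dlevel_def[of "2 * t - 1"] by (rule Least_le) (rule B)
  show "dlevel 1 < dlevel t"
    unfolding m less_Suc_eq_le dlevel_def[of 1] by (rule Least_le) simp
qed

lemma dyadic_unit_double:
  assumes "t \<in> dyadic_unit" "t \<le> 1 / 2"
  shows "2 * t \<in> dyadic_unit"
proof -
  obtain k :: int and n :: nat where kn: "t = of_int k / 2 ^ n"
    using assms(1) unfolding dyadic_unit_def by blast
  have "2 * t = of_int (2 * k) / 2 ^ n"
    by (simp add: kn)
  thus ?thesis
    by (rule dyadic_unitI) (use dyadic_unit_bounds[OF assms(1)] assms(2) in auto)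
qed

lemma dyadic_unit_double_minus:
  assumes "t \<in> dyadic_unit" "1 / 2 \<le> t"
  shows "2 * t - 1 \<in> dyadic_unit"
proof -
  obtain k :: int and n :: nat where kn: "t = of_int k / 2 ^ n"
    using assms(1) unfolding dyadic_unit_def by blast
  have "2 * t - 1 = of_int (2 * k - 2 ^ n) / 2 ^ n"
    by (simp add: kn field_simps)
  thus ?thesis
    by (rule dyadic_unitI) (use dyadic_unit_bounds[OF assms(1)] assms(2) in auto)
qed

text \<open>The two recursive clauses for t in [0,1/2] and [1/2,1] overlap at 1/2, where they agree; the
  clauses as stated on the closed half intervals are derived below. Off the index set the value is
  0 by convention.\<close>

function sharp :: "(rat \<Rightarrow> rat) \<Rightarrow> (rat \<Rightarrow> rat) \<Rightarrow> rat \<Rightarrow> rat"  (infixl "\<sharp>" 70) where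
  "(\<alpha> \<sharp> \<beta>) t =
    (if t \<notin> dyadic_unit then 0
     else if t = 0 then 0
     else if t = 1 then (\<alpha> 1 - \<alpha> 0) * (\<beta> 1 - \<beta> 0)
     else if t \<le> 1 / 2 then
       (lhalf \<alpha> \<sharp> lhalf \<beta>) (2 * t) + (rhalf \<alpha> \<sharp> rhalf \<beta>) (2 * t)
     else
       (lhalf \<alpha> \<sharp> lhalf \<beta>) 1 + (rhalf \<alpha> \<sharp> rhalf \<beta>) 1
       + (lhalf \<alpha> \<sharp> rhalf \<beta>) (2 * t - 1) + (rhalf \<alpha> \<sharp> lhalf \<beta>) (2 * t - 1))"
  by auto
termination
  by (relation "measure (\<lambda>(\<alpha>, \<beta>, t). dlevel t)") (auto simp: dlevel_less simp del: One_nat_def)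

declare sharp.simps [simp del]

definition eps :: "rat \<Rightarrow> rat" where
  "eps t = t - t\<^sup>2"

function phi :: "nat \<Rightarrow> rat \<Rightarrow> rat" where
  "phi m t =
    (if t \<notin> dyadic_unit then 0
     else if t = 0 \<or> t = 1 then 0
     else if t \<le> 1 / 2 then
       (if even m then (phi (m + 1) (2 * t) + (8 * of_nat m + 6) * t) / 8
        else (phi (m - 1) (2 * t) + eps (2 * t) + (8 * of_nat m + 6) * t) / 8)
     else
       (if m = 0 then (phi 0 (2 * t - 1) + 6 * (1 - t)) / 8
        else if even m then
          (phi (m - 1) (2 * t - 1) + eps (2 * t - 1) + (8 * of_nat m + 6) * (1 - t)) / 8
        else (phi (m + 1) (2 * t - 1) + (8 * of_nat m + 6) * (1 - t)) / 8))"
  by auto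
termination
  by (relation "measure (\<lambda>(m, t). dlevel t)") (auto simp: dlevel_less)

declare phi.simps [simp del]

lemma sharp_0 [simp]: "(\<alpha> \<sharp> \<beta>) 0 = 0"
  by (simp add: sharp.simps)

lemma sharp_1 [simp]: "(\<alpha> \<sharp> \<beta>) 1 = (\<alpha> 1 - \<alpha> 0) * (\<beta> 1 - \<beta> 0)"
  by (simp add: sharp.simps)

lemma sharp_left:
  assumes "t \<in> dyadic_unit" "t \<le> 1 / 2"
  shows "(\<alpha> \<sharp> \<beta>) t = (lhalf \<alpha> \<sharp> lhalf \<beta>) (2 * t) + (rhalf \<alpha> \<sharp> rhalf \<beta>) (2 * t)"
proof (cases "t = 0")
  case False
  with assms show ?thesis
    by (subst sharp.simps) auto
qed simp

lemma sharp_right: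
  assumes "t \<in> dyadic_unit" "1 / 2 \<le> t"
  shows "(\<alpha> \<sharp> \<beta>) t =
    (lhalf \<alpha> \<sharp> lhalf \<beta>) 1 + (rhalf \<alpha> \<sharp> rhalf \<beta>) 1
    + (lhalf \<alpha> \<sharp> rhalf \<beta>) (2 * t - 1) + (rhalf \<alpha> \<sharp> lhalf \<beta>) (2 * t - 1)"
proof -
  consider "t = 1 / 2" | "t = 1" | "1 / 2 < t" "t \<noteq> 1"
    using assms by fastforce
  thus ?thesis
  proof cases
    case 1
    show ?thesis
      using sharp_left[OF assms(1)] unfolding 1 by simp
  next
    case 2
    thus ?thesis
      by (simp add: lhalf_def rhalf_def algebra_simps)
  next
    case 3
    with assms show ?thesis
      by (subst sharp.simps) auto
  qed
qed

lemma lhalf_cong: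
  assumes "\<And>s. s \<in> dyadic_unit \<Longrightarrow> \<alpha> s = \<alpha>' s" "s \<in> dyadic_unit"
  shows "lhalf \<alpha> s = lhalf \<alpha>' s"
proof -
  obtain k :: int and n :: nat where kn: "s = of_int k / 2 ^ n"
    using assms(2) unfolding dyadic_unit_def by blast
  have "s / 2 = of_int k / 2 ^ Suc n"
    by (simp add: kn)
  hence "s / 2 \<in> dyadic_unit"
    by (rule dyadic_unitI) (use dyadic_unit_bounds[OF assms(2)] in auto)
  thus ?thesis
    by (simp add: lhalf_def assms(1))
qed

lemma rhalf_cong:
  assumes "\<And>s. s \<in> dyadic_unit \<Longrightarrow> \<alpha> s = \<alpha>' s" "s \<in> dyadic_unit"
  shows "rhalf \<alpha> s = rhalf \<alpha>' s"
proof -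
  obtain k :: int and n :: nat where kn: "s = of_int k / 2 ^ n"
    using assms(2) unfolding dyadic_unit_def by blast
  have "(1 + s) / 2 = of_int (2 ^ n + k) / 2 ^ Suc n"
    by (simp add: kn field_simps)
  hence "(1 + s) / 2 \<in> dyadic_unit"
    by (rule dyadic_unitI) (use dyadic_unit_bounds[OF assms(2)] in auto)
  thus ?thesis
    by (simp add: rhalf_def assms(1))
qed

lemma sharp_cong:
  assumes "\<And>s. s \<in> dyadic_unit \<Longrightarrow> \<alpha> s = \<alpha>' s"
    and "\<And>s. s \<in> dyadic_unit \<Longrightarrow> \<beta> s = \<beta>' s"
  shows "(\<alpha> \<sharp> \<beta>) t = (\<alpha>' \<sharp> \<beta>') t"
  using assms
proof (induction "dlevel t" arbitrary: t \<alpha> \<beta> \<alpha>' \<beta>' rule: less_induct)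
  case less
  show ?case
  proof (cases "t \<in> dyadic_unit \<and> t \<noteq> 0 \<and> t \<noteq> 1")
    case False
    thus ?thesis
      using less.prems by (auto simp: sharp.simps[of _ _ t])
  next
    case True
    note l = dlevel_less[of t]
    note c = lhalf_cong[of \<alpha> \<alpha>'] lhalf_cong[of \<beta> \<beta>'] rhalf_cong[of \<alpha> \<alpha>'] rhalf_cong[of \<beta> \<beta>']
    have ih: "(lhalf \<alpha> \<sharp> lhalf \<beta>) s = (lhalf \<alpha>' \<sharp> lhalf \<beta>') s"
      "(rhalf \<alpha> \<sharp> rhalf \<beta>) s = (rhalf \<alpha>' \<sharp> rhalf \<beta>') s"
      "(lhalf \<alpha> \<sharp> rhalf \<beta>) s = (lhalf \<alpha>' \<sharp> rhalf \<beta>') s"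
      "(rhalf \<alpha> \<sharp> lhalf \<beta>) s = (rhalf \<alpha>' \<sharp> lhalf \<beta>') s"
      if "dlevel s < dlevel t" for s
      by (rule less.hyps[OF that]; simp add: c less.prems)+
    show ?thesis
      using True l by (simp add: sharp.simps[of _ _ t] ih del: sharp_1)
  qed
qed

lemma phi_0 [simp]: "phi m 0 = 0"
  by (simp add: phi.simps)

lemma phi_1 [simp]: "phi m 1 = 0"
  by (simp add: phi.simps)

lemma phi_left_even:
  assumes "t \<in> dyadic_unit" "t \<le> 1 / 2" "even m"
  shows "8 * phi m t = phi (m + 1) (2 * t) + (8 * of_nat m + 6) * t"
proof (cases "t = 0")
  case False
  with assms show ?thesis
    by (subst phi.simps) auto
qed simp

lemma phi_left_odd:
  assumes "t \<in> dyadic_unit" "t \<le> 1 / 2" "odd m"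
  shows "8 * phi m t = phi (m - 1) (2 * t) + eps (2 * t) + (8 * of_nat m + 6) * t"
proof (cases "t = 0")
  case False
  with assms show ?thesis
    by (subst phi.simps) auto
qed (simp add: eps_def)

lemma phi_right_zero:
  assumes "t \<in> dyadic_unit" "1 / 2 \<le> t"
  shows "8 * phi 0 t = phi 0 (2 * t - 1) + 6 * (1 - t)"
proof -
  consider "t = 1 / 2" | "t = 1" | "1 / 2 < t" "t \<noteq> 1"
    using assms by fastforce
  thus ?thesis
  proof cases
    case 1
    show ?thesis
      using phi_left_even[OF assms(1), of 0] unfolding 1 by simp
  next
    case 3
    with assms show ?thesis
      by (subst phi.simps) auto
  qed simp
qed

lemma phi_right_even:
  assumes "t \<in> dyadic_unit" "1 / 2 \<le> t" "even m" "m \<noteq> 0"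
  shows "8 * phi m t = phi (m - 1) (2 * t - 1) + eps (2 * t - 1) + (8 * of_nat m + 6) * (1 - t)"
proof -
  consider "t = 1 / 2" | "t = 1" | "1 / 2 < t" "t \<noteq> 1"
    using assms by fastforce
  thus ?thesis
  proof cases
    case 1
    show ?thesis
      using phi_left_even[OF assms(1) _ assms(3)] unfolding 1 by (simp add: eps_def)
  next
    case 3
    with assms show ?thesis
      by (subst phi.simps) auto
  qed (simp add: eps_def)
qed

lemma phi_right_odd:
  assumes "t \<in> dyadic_unit" "1 / 2 \<le> t" "odd m"
  shows "8 * phi m t = phi (m + 1) (2 * t - 1) + (8 * of_nat m + 6) * (1 - t)"
proof -
  consider "t = 1 / 2" | "t = 1" | "1 / 2 < t" "t \<noteq> 1"
    using assms by fastforce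
  thus ?thesis
  proof cases
    case 1
    show ?thesis
      using phi_left_odd[OF assms(1) _ assms(3)] unfolding 1 by (simp add: eps_def)
  next
    case 3
    with assms show ?thesis
      by (subst phi.simps) auto
  qed simp
qed

definition E1 :: "rat \<Rightarrow> rat" where
  "E1 = eps \<sharp> phi 0"

end

theory Submission imports Defs begin

text \<open>
  Unfolding the product on the left halves shows that \<open>(\<alpha> \<sharp> \<beta>) (1 / 2 ^ n)\<close> is the sum, over the
  \<open>2 ^ n\<close> dyadic intervals of length \<open>1 / 2 ^ n\<close>, of the products of the increments of \<open>\<alpha>\<close> and
  \<open>\<beta>\<close> (\<open>sharp_inverse_power_2\<close>). The increments of \<open>eps\<close> are linear in the index of the interval,
  so summation by parts turns \<open>E1 (1 / 2 ^ n) * 2 ^ n\<close> into twice the mean of \<open>phi 0\<close> over the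
  points \<open>i / 2 ^ n\<close> (\<open>E1_eq_dyadic_mean\<close>). The limit is thus twice the integral of \<open>phi 0\<close>.

  The two halves of \<open>phi m\<close> add up to an expression in \<open>phi (m + 1)\<close>, \<open>phi (m - 1)\<close> and \<open>eps\<close> in
  which the parity of \<open>m\<close> has disappeared and the linear terms have become a constant. The integrals
  \<open>A m\<close> must therefore satisfy the linear recurrence
  \<open>16 * A m = A (m + 1) + A (m - 1) + 1 / 6 + (4 * m + 3)\<close> for \<open>m > 0\<close>, with the boundary condition
  \<open>15 * A 0 = A 1 + 3\<close>. The roots of \<open>x\<^sup>2 - 16 * x + 1\<close> are \<open>8 - 3 * sqrt 7\<close> and its inverse; the
  solution of linear growth is
  \<open>A m = 2 * m / 7 + 19 / 84 + C * (8 - 3 * sqrt 7) ^ m\<close>, and the boundary condition determines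
  \<open>C\<close>. That the means of \<open>phi m\<close> really converge to this solution follows by induction on \<open>n\<close>: the
  recurrence contracts so strongly that the error is at most \<open>(m + 1) / 4 ^ n\<close>
  (\<open>dyadic_mean_phi_error\<close>).
\<close>

section \<open>Dyadic sums and means\<close>

lemma sum_lessThan_add:
  fixes f :: "nat \<Rightarrow> 'a :: comm_monoid_add"
  shows "(\<Sum>i<m + n. f i) = (\<Sum>i<m. f i) + (\<Sum>i<n. f (m + i))"
  by (induction n) (simp_all add: add_ac)

lemma sum_halves:
  fixes g :: "rat \<Rightarrow> rat"
  shows "(\<Sum>i<2 ^ Suc n. g (of_nat i / 2 ^ Suc n)) =
    (\<Sum>i<2 ^ n. g ((of_nat i / 2 ^ n) / 2) + g ((1 + of_nat i / 2 ^ n) / 2))"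
proof -
  have "(1 + of_nat i / 2 ^ n) / 2 = (of_nat (2 ^ n + i) / 2 ^ Suc n :: rat)" for i
    by (simp add: field_simps)
  moreover have "(2 :: nat) ^ Suc n = 2 ^ n + 2 ^ n"
    by simp
  ultimately show ?thesis
    by (simp only: sum_lessThan_add sum.distrib) (simp add: mult.commute)
qed

definition dyadic_mean :: "nat \<Rightarrow> (rat \<Rightarrow> rat) \<Rightarrow> rat" where
  "dyadic_mean n f = (\<Sum>i<2 ^ n. f (of_nat i / 2 ^ n)) / 2 ^ n"

lemma dyadic_mean_0: "dyadic_mean 0 f = f 0"
  by (simp add: dyadic_mean_def)

lemma dyadic_mean_Suc:
  "dyadic_mean (Suc n) f = dyadic_mean n (\<lambda>t. (f (t / 2) + f ((1 + t) / 2)) / 2)"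
  unfolding dyadic_mean_def sum_halves
  by (simp flip: sum_divide_distrib)

lemma dyadic_mean_add:
  "dyadic_mean n (\<lambda>t. f t + g t) = dyadic_mean n f + dyadic_mean n g"
  by (simp add: dyadic_mean_def sum.distrib add_divide_distrib)

lemma dyadic_mean_divide:
  "dyadic_mean n (\<lambda>t. f t / c) = dyadic_mean n f / c"
  by (simp add: dyadic_mean_def mult.commute flip: sum_divide_distrib)

lemma dyadic_mean_const: "dyadic_mean n (\<lambda>t. c) = c"
  by (simp add: dyadic_mean_def)

lemma grid_point_in_dyadic_unit:
  assumes "i < 2 ^ n"
  shows "of_nat i / 2 ^ n \<in> dyadic_unit"
proof (rule dyadic_unitI[of _ "int i" n])
  have "(of_nat i :: rat) \<le> of_nat (2 ^ n)"
    using assms by (simp only: of_nat_le_iff)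
  thus "of_nat i / 2 ^ n \<le> (1 :: rat)"
    by simp
qed simp_all

lemma dyadic_mean_cong:
  assumes "\<And>t. t \<in> dyadic_unit \<Longrightarrow> f t = g t"
  shows "dyadic_mean n f = dyadic_mean n g"
  unfolding dyadic_mean_def by (simp add: assms grid_point_in_dyadic_unit)

lemma half_in_dyadic_unit:
  assumes "t \<in> dyadic_unit"
  shows "t / 2 \<in> dyadic_unit" "(1 + t) / 2 \<in> dyadic_unit"
proof -
  obtain k :: int and n where kn: "t = of_int k / 2 ^ n"
    using assms unfolding dyadic_unit_def by blast
  have "t / 2 = of_int k / 2 ^ Suc n" "(1 + t) / 2 = of_int (2 ^ n + k) / 2 ^ Suc n"
    by (simp_all add: kn field_simps)
  moreover have "0 \<le> t / 2" "t / 2 \<le> 1" "0 \<le> (1 + t) / 2" "(1 + t) / 2 \<le> 1"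
    using dyadic_unit_bounds[OF assms] by simp_all
  ultimately show "t / 2 \<in> dyadic_unit" "(1 + t) / 2 \<in> dyadic_unit"
    by (metis dyadic_unitI)+
qed

section \<open>The product at negative powers of two\<close>

text \<open>Each doubling of \<open>1 / 2 ^ n\<close> replaces the pair of functions by the pair of their left halves
  and the pair of their right halves. After \<open>n\<close> steps the argument is 1, where the product is that of
  the total increments of the restrictions to a single dyadic interval.\<close>

lemma sharp_inverse_power_2:
  "(\<alpha> \<sharp> \<beta>) (1 / 2 ^ n) =
    (\<Sum>i<2 ^ n. (\<alpha> (of_nat i / 2 ^ n + 1 / 2 ^ n) - \<alpha> (of_nat i / 2 ^ n)) *
      (\<beta> (of_nat i / 2 ^ n + 1 / 2 ^ n) - \<beta> (of_nat i / 2 ^ n)))"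
proof (induction n arbitrary: \<alpha> \<beta>)
  case 0
  show ?case by simp
next
  case (Suc n)
  have "1 / 2 ^ Suc n \<le> (1 :: rat) / 2"
    by (simp add: field_simps)
  moreover have "(1 / 2 ^ Suc n :: rat) \<in> dyadic_unit"
    using grid_point_in_dyadic_unit[of 1 "Suc n"] one_less_power[of "2 :: nat" "Suc n"]
    by (simp del: power_Suc)
  ultimately have "(\<alpha> \<sharp> \<beta>) (1 / 2 ^ Suc n) =
      (lhalf \<alpha> \<sharp> lhalf \<beta>) (1 / 2 ^ n) + (rhalf \<alpha> \<sharp> rhalf \<beta>) (1 / 2 ^ n)"
    by (subst sharp_left) simp_all
  moreover have "x / 2 + 1 / 2 ^ Suc n = (x + 1 / 2 ^ n) / 2"
      "(1 + x) / 2 + 1 / 2 ^ Suc n = (1 + (x + 1 / 2 ^ n)) / 2" for x :: rat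
    by (simp_all add: field_simps)
  ultimately show ?case
    unfolding Suc.IH
      sum_halves[of "\<lambda>x. (\<alpha> (x + 1 / 2 ^ Suc n) - \<alpha> x) * (\<beta> (x + 1 / 2 ^ Suc n) - \<beta> x)"]
    by (simp only: lhalf_def rhalf_def sum.distrib)
qed

lemma sum_by_parts_linear:
  fixes f :: "nat \<Rightarrow> 'a :: comm_ring_1"
  shows "(\<Sum>i<k. (c - d * (2 * of_nat i + 1)) * (f (Suc i) - f i)) =
    (c - d * (2 * of_nat k - 1)) * f k - (c + d) * f 0 + 2 * d * (\<Sum>i<k. f i)"
  by (induction k) (simp_all add: algebra_simps)

text \<open>The second differences of \<open>eps\<close> are constant and \<open>phi 0\<close> vanishes at both ends, so summation
  by parts leaves only a multiple of the sum of the values of \<open>phi 0\<close>.\<close>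

lemma E1_eq_dyadic_mean: "E1 (1 / 2 ^ n) * 2 ^ n = 2 * dyadic_mean n (phi 0)"
proof -
  define h :: rat where "h = 1 / 2 ^ n"
  have h: "2 ^ n * h = 1" "h \<noteq> 0"
    by (simp_all add: h_def)
  have grid: "of_nat i / 2 ^ n = of_nat i * h" for i
    by (simp add: h_def)
  have increment: "eps (of_nat i * h + h) - eps (of_nat i * h) = h * (1 - h * (2 * of_nat i + 1))"
    for i by (simp add: eps_def power2_eq_square algebra_simps)
  have "of_nat i * h + h = of_nat (Suc i) * h" for i
    by (simp add: algebra_simps)
  note step = this
  have "E1 (1 / 2 ^ n) * 2 ^ n =
      2 ^ n * (\<Sum>i<2 ^ n. (eps (of_nat i * h + h) - eps (of_nat i * h)) *
        (phi 0 (of_nat i * h + h) - phi 0 (of_nat i * h)))"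
    unfolding E1_def sharp_inverse_power_2 grid by (simp only: h_def mult.commute)
  also have "\<dots> = 2 ^ n * (\<Sum>i<2 ^ n. h * (1 - h * (2 * of_nat i + 1)) *
        (phi 0 (of_nat (Suc i) * h) - phi 0 (of_nat i * h)))"
    by (simp only: increment flip: step)
  also have "\<dots> = 2 ^ n * h * (\<Sum>i<2 ^ n. (1 - h * (2 * of_nat i + 1)) *
        (phi 0 (of_nat (Suc i) * h) - phi 0 (of_nat i * h)))"
    by (simp only: sum_distrib_left mult.assoc)
  also have "\<dots> = 2 * h * (\<Sum>i<2 ^ n. phi 0 (of_nat i * h))"
    unfolding sum_by_parts_linear[of 1 h "\<lambda>i. phi 0 (of_nat i * h)"]
    by (simp add: h)
  finally show ?thesis
    unfolding dyadic_mean_def grid by (simp add: h_def)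
qed

section \<open>The recurrence for the means\<close>

lemma dyadic_mean_eps: "dyadic_mean n eps = (1 - 1 / 4 ^ n) / 6"
proof (induction n)
  case 0
  show ?case by (simp add: dyadic_mean_0 eps_def)
next
  case (Suc n)
  have "(\<lambda>t. (eps (t / 2) + eps ((1 + t) / 2)) / 2) = (\<lambda>t. eps t / 4 + 1 / 8)"
    by (auto simp: eps_def power2_eq_square field_simps)
  hence "dyadic_mean (Suc n) eps = dyadic_mean n eps / 4 + 1 / 8"
    by (simp only: dyadic_mean_Suc dyadic_mean_add dyadic_mean_divide dyadic_mean_const)
  thus ?case
    by (simp add: Suc.IH field_simps)
qed

lemma phi_zero_halves_sum:
  assumes "t \<in> dyadic_unit"
  shows "8 * (phi 0 (t / 2) + phi 0 ((1 + t) / 2)) = phi 1 t + phi 0 t + 3"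
  using phi_left_even[of "t / 2" 0] phi_right_zero[of "(1 + t) / 2"]
    half_in_dyadic_unit[OF assms] dyadic_unit_bounds[OF assms]
  by (simp add: field_simps)

text \<open>For odd \<open>m\<close> the two halves merely exchange the roles that they have for even \<open>m\<close>, and the
  linear terms in \<open>t\<close> and \<open>1 - t\<close> cancel up to a constant.\<close>

lemma phi_Suc_halves_sum:
  assumes "t \<in> dyadic_unit"
  shows "8 * (phi (Suc m) (t / 2) + phi (Suc m) ((1 + t) / 2)) =
    phi (Suc (Suc m)) t + phi m t + eps t + (4 * of_nat m + 7)"
proof (cases "even m")
  case True
  thus ?thesis
    using phi_left_odd[of "t / 2" "Suc m"] phi_right_odd[of "(1 + t) / 2" "Suc m"]
      half_in_dyadic_unit[OF assms] dyadic_unit_bounds[OF assms]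
    by (simp add: field_simps)
next
  case False
  thus ?thesis
    using phi_left_even[of "t / 2" "Suc m"] phi_right_even[of "(1 + t) / 2" "Suc m"]
      half_in_dyadic_unit[OF assms] dyadic_unit_bounds[OF assms]
    by (simp add: field_simps)
qed

lemma dyadic_mean_phi_zero:
  "16 * dyadic_mean (Suc n) (phi 0) = dyadic_mean n (phi 1) + dyadic_mean n (phi 0) + 3"
proof -
  have "dyadic_mean (Suc n) (phi 0) = dyadic_mean n (\<lambda>t. (phi 1 t + phi 0 t + 3) / 16)"
    unfolding dyadic_mean_Suc by (rule dyadic_mean_cong, drule phi_zero_halves_sum) (simp add: field_simps)
  thus ?thesis
    by (simp add: dyadic_mean_add dyadic_mean_divide dyadic_mean_const)
qed

lemma dyadic_mean_phi_Suc:
  "16 * dyadic_mean (Suc n) (phi (Suc m)) =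
    dyadic_mean n (phi (Suc (Suc m))) + dyadic_mean n (phi m)
      + (1 - 1 / 4 ^ n) / 6 + (4 * of_nat m + 7)"
proof -
  have "dyadic_mean (Suc n) (phi (Suc m)) =
      dyadic_mean n (\<lambda>t. (phi (Suc (Suc m)) t + phi m t + eps t + (4 * of_nat m + 7)) / 16)"
    unfolding dyadic_mean_Suc by (rule dyadic_mean_cong, drule phi_Suc_halves_sum[of _ m]) (simp add: field_simps)
  thus ?thesis
    by (simp add: dyadic_mean_add dyadic_mean_divide dyadic_mean_const dyadic_mean_eps)
qed

section \<open>The limits of the means\<close>

text \<open>The sequence \<open>2 * m / 7 + 19 / 84\<close> solves the inhomogeneous recurrence for \<open>m > 0\<close>. Writing
  \<open>r = 8 - 3 * sqrt 7\<close> and \<open>C\<close> for the coefficient of \<open>r ^ m\<close>, the boundary condition at \<open>m = 0\<close>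
  amounts to \<open>C * (15 - r) = 5 / 42\<close>.\<close>

definition phi_integral :: "nat \<Rightarrow> real" where
  "phi_integral m =
    2 * real m / 7 + 19 / 84 + 5 * (3 * sqrt 7 - 7) / 588 * (8 - 3 * sqrt 7) ^ m"

lemma sqrt_7_bounds: "13 / 5 < sqrt 7" "sqrt 7 < 8 / 3"
  by (rule real_less_rsqrt real_less_lsqrt; simp add: power2_eq_square)+

lemma phi_integral_zero: "16 * phi_integral 0 = phi_integral 1 + phi_integral 0 + 3"
proof -
  have "sqrt 7 * sqrt 7 = 7"
    by simp
  thus ?thesis
    by (simp add: phi_integral_def field_simps del: real_sqrt_mult_self)
qed

lemma phi_integral_Suc:
  "16 * phi_integral (Suc m) =
    phi_integral (Suc (Suc m)) + phi_integral m + 1 / 6 + (4 * real m + 7)"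
proof -
  define r :: real where "r = 8 - 3 * sqrt 7"
  have square: "r * r = 16 * r - 1"
    by (simp add: r_def algebra_simps)
  have power: "c * r ^ Suc (Suc m) = 16 * (c * r ^ Suc m) - c * r ^ m" for c
  proof -
    have "c * r ^ Suc (Suc m) = c * (r * r) * r ^ m"
      by simp
    thus ?thesis
      unfolding square by (simp add: algebra_simps)
  qed
  show ?thesis
    unfolding phi_integral_def r_def[symmetric] power by (simp add: field_simps)
qed

text \<open>The means of level 0 vanish, so this bound on the limits themselves is what starts the induction
  for the error estimate. The upper bound is what excludes multiples of the growing solution
  \<open>(8 + 3 * sqrt 7) ^ m\<close>.\<close>

lemma phi_integral_bounds: "0 \<le> phi_integral m" "phi_integral m \<le> real m + 1"
proof -
  let ?c = "5 * (3 * sqrt 7 - 7) / 588 :: real" and ?r = "8 - 3 * sqrt 7 :: real"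
  have r: "0 \<le> ?r" "?r \<le> 1" and c: "0 \<le> ?c" "?c \<le> 1 / 2"
    using sqrt_7_bounds by simp_all
  hence "0 \<le> ?c * ?r ^ m" "?c * ?r ^ m \<le> 1 / 2 * 1"
    by (intro mult_nonneg_nonneg mult_mono zero_le_power power_le_one; simp)+
  thus "0 \<le> phi_integral m" "phi_integral m \<le> real m + 1"
    unfolding phi_integral_def by linarith+
qed

text \<open>One step of the recurrence divides the weight \<open>m + 1\<close> by 8, since
  \<open>(m + 2) + m = 2 * (m + 1)\<close> is divided by 16, but the bound only has to decrease by a factor of 4,
  the rate at which the mean of \<open>eps\<close> converges. The slack absorbs the error in that mean; for
  \<open>m = 0\<close> it makes up for \<open>phi 0\<close> itself appearing in place of a function of index \<open>-1\<close>:
  the weights then add up to \<open>2 + 1 = 3\<close>, which is still at most \<open>16 / 4\<close>.\<close>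

lemma dyadic_mean_phi_error:
  "\<bar>real_of_rat (dyadic_mean n (phi m)) - phi_integral m\<bar> \<le> (real m + 1) / 4 ^ n"
proof (induction n arbitrary: m)
  case 0
  show ?case
    using phi_integral_bounds[of m] by (simp add: dyadic_mean_0)
next
  case (Suc n)
  define q :: real where "q = 1 / 4 ^ n"
  define D where "D n m = real_of_rat (dyadic_mean n (phi m)) - phi_integral m" for n m
  have "q \<ge> 0"
    by (simp add: q_def)
  have IH: "\<bar>D n k\<bar> \<le> real k * q + q" for k
    using Suc.IH[of k] by (simp add: D_def q_def add_divide_distrib)
  have "4 * \<bar>D (Suc n) m\<bar> \<le> real m * q + q"
  proof (cases m)
    case 0
    have "16 * D (Suc n) 0 = D n 1 + D n 0"
      using arg_cong[OF dyadic_mean_phi_zero, of real_of_rat n] phi_integral_zero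
      by (simp add: D_def of_rat_add of_rat_mult)
    moreover have "\<bar>D n 0\<bar> \<le> q" "\<bar>D n 1\<bar> \<le> 2 * q"
      using IH[of 0] IH[of 1] by simp_all
    ultimately have "4 * \<bar>D (Suc n) 0\<bar> \<le> q"
      using \<open>q \<ge> 0\<close> by linarith
    thus ?thesis
      by (simp add: 0)
  next
    case m: (Suc k)
    have "16 * D (Suc n) (Suc k) = D n (Suc (Suc k)) + D n k - q / 6"
      using arg_cong[OF dyadic_mean_phi_Suc, of real_of_rat n k] phi_integral_Suc[of k]
      by (simp add: D_def of_rat_add of_rat_mult of_rat_diff of_rat_divide of_rat_power q_def
          diff_divide_distrib)
    moreover have "\<bar>D n (Suc (Suc k))\<bar> \<le> real k * q + 3 * q"
      using IH[of "Suc (Suc k)"] by (simp add: algebra_simps)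
    moreover have "real k * q \<ge> 0"
      using \<open>q \<ge> 0\<close> by simp
    ultimately have "4 * \<bar>D (Suc n) (Suc k)\<bar> \<le> real k * q + 2 * q"
      using IH[of k] \<open>q \<ge> 0\<close> by linarith
    thus ?thesis
      by (simp add: m algebra_simps)
  qed
  thus ?case
    by (simp add: D_def q_def field_simps)
qed

lemma dyadic_mean_phi_tendsto:
  "(\<lambda>n. real_of_rat (dyadic_mean n (phi m))) \<longlonglongrightarrow> phi_integral m"
proof -
  have "(\<lambda>n. (real m + 1) * (1 / 4) ^ n) \<longlonglongrightarrow> 0"
    by (intro tendsto_mult_right_zero LIMSEQ_realpow_zero) simp_all
  hence "(\<lambda>n. real_of_rat (dyadic_mean n (phi m)) - phi_integral m) \<longlonglongrightarrow> 0"
    by (rule tendsto_0_le[where K = 1])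
      (use dyadic_mean_phi_error in \<open>simp add: power_divide\<close>)
  thus ?thesis
    by (simp add: LIM_zero_iff)
qed

theorem theorem2p4:
  "(\<lambda>n. real_of_rat (E1 (1 / 2 ^ n)) * 2 ^ n) \<longlonglongrightarrow> 1 / 3 + 5 / (14 * sqrt 7)"
proof -
  have "real_of_rat (E1 (1 / 2 ^ n)) * 2 ^ n = 2 * real_of_rat (dyadic_mean n (phi 0))" for n
    using arg_cong[OF E1_eq_dyadic_mean, of real_of_rat n]
    by (simp add: of_rat_mult of_rat_power)
  moreover have "2 * phi_integral 0 = 1 / 3 + 5 / (14 * sqrt 7)"
    by (simp add: phi_integral_def field_simps)
  ultimately show ?thesis
    using tendsto_mult_left[OF dyadic_mean_phi_tendsto[of 0], of 2] by simp
qed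

end
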